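(* Let $p$ be an odd prime and let $G=D_p\times D_p$. Then the spectrum of the Laplacian matrix $L(\mathcal{S}_{D_p\times D_p})$ of the superpower graph of $D_p\times D_p$ consists of the eigenvalues $3p^2-2p$ with multiplicity $p^2-2$, $4p^2$ with multiplicity $2p^2-2p+1$, $3p^2+1$ with multiplicity $p^2+2p-1$, $2p^2-2p+1$ with multiplicity $1$, and $0$ with multiplicity $1$.
   Context: $D_n$ denotes the dihedral group of order $2n$, generated by $a,b$ with $o(a)=n$, $o(b)=2$, $ba=a^{-1}b$; $o(x)$ is the order of a group element $x$. For a finite group $G$, the superpower graph $\mathcal{S}_G$ is the simple undirected graph whose vertex set is $G$, with two distinct vertices $x,y$ adjacent if and only if $o(x)\mid o(y)$ or $o(y)\mid o(x)$. For a graph $\Gamma$ with adjacency matrix $A(\Gamma)$ and diagonal matrix of vertex degrees $D(\Gamma)$, the Laplacian matrix is $L(\Gamma)=D(\Gamma)-A(\Gamma)$. *)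

theory Defs
  imports
    "HOL-Algebra.Generated_Groups"
    "HOL-Algebra.Multiplicative_Group"
    "Graph_Theory.Pair_Digraph"
    "Jordan_Normal_Form.Spectral_Radius"
begin

definition dihedral_group :: "nat \<Rightarrow> ('a, 'm) monoid_scheme \<Rightarrow> bool" where
  "dihedral_group n G \<longleftrightarrow>
     group G \<and> card (carrier G) = 2 * n \<and>
     (\<exists>a \<in> carrier G. \<exists>b \<in> carrier G.
        generate G {a, b} = carrier G \<and>
        group.ord G a = n \<and> group.ord G b = 2 \<and>
        b \<otimes>\<^bsub>G\<^esub> a = inv\<^bsub>G\<^esub> a \<otimes>\<^bsub>G\<^esub> b)"

text \<open>
  Simple undirected graphs are represented as in \<^locale>\<open>pair_graph\<close>: finite, loop-free, symmetric
  sets of ordered pairs, so that an undirected edge \<open>{x, y}\<close> is the pair of arcs \<open>(x, y)\<close>, \<open>(y, x)\<close>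
  and the degree of a vertex is its out-degree.
\<close>

definition superpower_graph :: "('a, 'm) monoid_scheme \<Rightarrow> 'a pair_pre_digraph" where
  "superpower_graph G =
     \<lparr> pverts = carrier G,
       parcs = {(x, y). x \<in> carrier G \<and> y \<in> carrier G \<and> x \<noteq> y \<and>
                  (group.ord G x dvd group.ord G y \<or> group.ord G y dvd group.ord G x)} \<rparr>"

lemma pair_graph_superpower_graph:
  assumes "finite (carrier G)"
  shows "pair_graph (superpower_graph G)"
proof -
  have "finite (parcs (superpower_graph G))"
    by (rule finite_subset[of _ "carrier G \<times> carrier G"])
       (auto simp: superpower_graph_def assms)
  then show ?thesis
    using assms
    by unfold_locales
       (auto simp: superpower_graph_def symmetric_def sym_def with_proj_def arcs_ends_conv)
qed

text \<open>
  The matrices of a graph depend on an enumeration \<open>vs\<close> of its vertices (a distinct list with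
  \<open>set vs = pverts \<Gamma>\<close>); row and column \<open>i\<close> belong to the vertex \<open>vs ! i\<close>.
\<close>

definition adjacency_matrix :: "'a pair_pre_digraph \<Rightarrow> 'a list \<Rightarrow> real mat" where
  "adjacency_matrix \<Gamma> vs =
     mat (length vs) (length vs) (\<lambda>(i, j). if (vs ! i, vs ! j) \<in> parcs \<Gamma> then 1 else 0)"

definition degree_matrix :: "'a pair_pre_digraph \<Rightarrow> 'a list \<Rightarrow> real mat" where
  "degree_matrix \<Gamma> vs =
     mat (length vs) (length vs)
       (\<lambda>(i, j). if i = j then real (out_degree (with_proj \<Gamma>) (vs ! i)) else 0)"

definition laplacian_matrix :: "'a pair_pre_digraph \<Rightarrow> 'a list \<Rightarrow> real mat" where
  "laplacian_matrix \<Gamma> vs = degree_matrix \<Gamma> vs - adjacency_matrix \<Gamma> vs"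

text \<open>
  The qualified name is needed because HOL-Algebra uses \<open>order\<close> for the cardinality of a group.
\<close>

definition eigenvalue_multiplicity :: "'a :: field mat \<Rightarrow> 'a \<Rightarrow> nat" where
  "eigenvalue_multiplicity A k = Polynomial.order k (char_poly A)"

text \<open>
  The concrete model below only witnesses that \<^const>\<open>dihedral_group\<close> is satisfiable:
  \<open>(i, s)\<close> stands for \<open>a\<^sup>i b\<^sup>s\<close>.
\<close>

definition dihedral_model :: "nat \<Rightarrow> (int \<times> bool) monoid" where
  "dihedral_model n =
     \<lparr> carrier = {0..<int n} \<times> UNIV,
       monoid.mult = (\<lambda>(i, s) (j, t). ((i + (if s then - j else j)) mod int n, s \<noteq> t)),
       one = (0, False) \<rparr>"

lemma dihedral_group_dihedral_model:
  assumes n: "n > 0"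
  shows "dihedral_group n (dihedral_model n)"
proof -
  let ?G = "dihedral_model n"
  let ?a = "(1 mod int n, False)" and ?b = "(0 :: int, True)"
  have car: "carrier ?G = {0..<int n} \<times> UNIV" and one: "\<one>\<^bsub>?G\<^esub> = (0, False)"
    and mul: "\<And>i s j t. (i, s) \<otimes>\<^bsub>?G\<^esub> (j, t) =
                ((i + (if s then - j else j)) mod int n, s \<noteq> t)"
    by (simp_all add: dihedral_model_def)
  interpret group ?G
  proof (rule groupI)
    fix x y z assume "x \<in> carrier ?G" "y \<in> carrier ?G" "z \<in> carrier ?G"
    then show "x \<otimes>\<^bsub>?G\<^esub> y \<otimes>\<^bsub>?G\<^esub> z = x \<otimes>\<^bsub>?G\<^esub> (y \<otimes>\<^bsub>?G\<^esub> z)"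
      by (cases x; cases y; cases z)
         (auto simp: mul mod_simps algebra_simps)
  next
    fix x assume x: "x \<in> carrier ?G"
    obtain i s where [simp]: "x = (i, s)" by (cases x)
    have "(if s then (i, True) else ((- i) mod int n, False)) \<otimes>\<^bsub>?G\<^esub> x = \<one>\<^bsub>?G\<^esub>"
      by (auto simp: mul one mod_simps)
    moreover have "(if s then (i, True) else ((- i) mod int n, False)) \<in> carrier ?G"
      using x n by (auto simp: car)
    ultimately show "\<exists>y \<in> carrier ?G. y \<otimes>\<^bsub>?G\<^esub> x = \<one>\<^bsub>?G\<^esub>" by blast
  qed (use n in \<open>auto simp: car one mul\<close>)
  have a: "?a \<in> carrier ?G" and b: "?b \<in> carrier ?G"
    using n by (auto simp: car)
  have pow: "?a [^]\<^bsub>?G\<^esub> k = (int k mod int n, False)" for k :: nat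
    by (induction k) (auto simp: one mul mod_simps algebra_simps)
  have orda: "group.ord ?G ?a = n"
    by (subst ord_unique[OF a]) (simp add: pow one flip: zmod_int, simp add: mod_eq_0_iff_dvd)
  have bb: "?b \<otimes>\<^bsub>?G\<^esub> ?b = \<one>\<^bsub>?G\<^esub>"
    by (simp add: mul one)
  have bpow: "?b [^]\<^bsub>?G\<^esub> k = (0, odd k)" for k :: nat
    by (induction k) (auto simp: one mul)
  have ordb: "group.ord ?G ?b = 2"
    by (subst ord_unique[OF b]) (simp add: bpow one)
  have inva: "inv\<^bsub>?G\<^esub> ?a = ((- 1) mod int n, False)"
    by (rule inv_equality) (use n in \<open>auto simp: mul one car mod_simps\<close>)
  have rel: "?b \<otimes>\<^bsub>?G\<^esub> ?a = inv\<^bsub>?G\<^esub> ?a \<otimes>\<^bsub>?G\<^esub> ?b"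
    by (simp add: inva mul mod_simps)
  have "carrier ?G \<subseteq> generate ?G {?a, ?b}"
  proof
    fix x assume "x \<in> carrier ?G"
    then obtain i s where x: "x = (i, s)" "0 \<le> i" "i < int n" by (auto simp: car)
    have apow: "?a [^]\<^bsub>?G\<^esub> k \<in> generate ?G {?a, ?b}" for k :: nat
      by (induction k) (auto intro: generate.intros)
    have ai: "(i, False) \<in> generate ?G {?a, ?b}"
      using apow[of "nat i"] x by (simp add: pow)
    moreover have "(i, False) \<otimes>\<^bsub>?G\<^esub> ?b \<in> generate ?G {?a, ?b}"
      by (rule generate.eng[OF ai]) (auto intro: generate.intros)
    ultimately show "x \<in> generate ?G {?a, ?b}"
      using x by (cases s) (auto simp: mul)
  qed
  moreover have "generate ?G {?a, ?b} \<subseteq> carrier ?G"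
    using generate_incl[of "{?a, ?b}"] a b by simp
  ultimately have gen: "generate ?G {?a, ?b} = carrier ?G" by blast
  have "card (carrier ?G) = 2 * n"
    by (simp add: car card_cartesian_product)
  then show ?thesis
    unfolding dihedral_group_def using is_group a b gen orda ordb rel by blast
qed

end

theory Submission
  imports Defs
begin

text \<open>
  With \<open>A\<close> and \<open>B\<close> the sets of elements of order \<open>p\<close> and \<open>2\<close>, every remaining element has order \<open>1\<close>
  or \<open>2p\<close> and is adjacent to all others, so the graph is the join of a clique with the disjoint
  union of the cliques \<open>A\<close> and \<open>B\<close>. Adding a multiple of the all-ones matrix to a matrix with
  constant row sums changes its determinant by an explicit factor; doing this twice makes
  \<open>x I - L\<close> block diagonal.
\<close>

section \<open>Determinants of matrices indexed by a list, and their change under multiples of the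
  all-ones matrix\<close>

text \<open>Entries depend on the list members rather than on positions, so reordering the list
  permutes rows and columns simultaneously, and splitting it gives a block decomposition.\<close>

definition enum_mat :: "('b \<Rightarrow> 'b \<Rightarrow> 'a) \<Rightarrow> 'b list \<Rightarrow> 'a mat" where
  "enum_mat f vs = mat (length vs) (length vs) (\<lambda>(i, j). f (vs ! i) (vs ! j))"

lemma enum_mat_carrier [simp]: "enum_mat f vs \<in> carrier_mat (length vs) (length vs)"
  and dim_row_enum_mat [simp]: "dim_row (enum_mat f vs) = length vs"
  and dim_col_enum_mat [simp]: "dim_col (enum_mat f vs) = length vs"
  by (simp_all add: enum_mat_def)

lemma index_enum_mat [simp]:
  "i < length vs \<Longrightarrow> j < length vs \<Longrightarrow> enum_mat f vs $$ (i, j) = f (vs ! i) (vs ! j)"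
  by (simp add: enum_mat_def)

lemma enum_mat_cong:
  assumes "\<And>x y. x \<in> set vs \<Longrightarrow> y \<in> set vs \<Longrightarrow> f x y = g x y"
  shows "enum_mat f vs = enum_mat g vs"
  using assms by (auto simp: enum_mat_def intro!: eq_matI)

text \<open>One permutation acts on both rows and columns, so its sign enters twice and
  cancels.\<close>

lemma det_enum_mat_mset_eq:
  fixes f :: "'b \<Rightarrow> 'b \<Rightarrow> 'a :: comm_ring_1"
  assumes "mset us = mset vs"
  shows "det (enum_mat f us) = det (enum_mat f vs)"
proof -
  let ?n = "length vs"
  obtain \<pi> where \<pi>: "\<pi> permutes {..<?n}" "permute_list \<pi> vs = us"
    using mset_eq_permutation[OF assms] .
  have \<pi>0: "\<pi> permutes {0..<?n}"
    using \<pi>(1) by (simp add: lessThan_atLeast0)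
  have len: "length us = ?n"
    using \<pi>(2) by auto
  have nth: "us ! i = vs ! \<pi> i" and lt: "\<pi> i < ?n" if "i < ?n" for i
    using that \<pi> permute_list_nth[OF \<pi>(1)] permutes_in_image[OF \<pi>(1)] by auto
  \<comment> \<open>\<open>B\<close> is the halfway stage with only the rows permuted; the columns
    follow by permuting the rows of its transpose.\<close>
  define B where "B = mat ?n ?n (\<lambda>(i, j). enum_mat f vs $$ (\<pi> i, j))"
  have B: "B \<in> carrier_mat ?n ?n" by (simp add: B_def)
  have "transpose_mat (enum_mat f us) = mat ?n ?n (\<lambda>(i, j). transpose_mat B $$ (\<pi> i, j))"
    by (rule eq_matI) (auto simp: len nth lt B_def)
  then have "det (transpose_mat (enum_mat f us)) = signof \<pi> * det (transpose_mat B)"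
    using det_permute_rows[OF _ \<pi>0, of "transpose_mat B"] B by simp
  moreover have "det B = signof \<pi> * det (enum_mat f vs)"
    unfolding B_def by (rule det_permute_rows[OF _ \<pi>0]) simp
  ultimately show ?thesis
    using B by (simp add: det_transpose[OF enum_mat_carrier] det_transpose[OF B] sign_def)
qed

text \<open>With \<open>us\<close> listed first, the matrix is block lower triangular. This splits
  off first \<open>C\<close>, then \<open>A\<close> from \<open>B\<close>.\<close>

lemma det_enum_mat_append:
  fixes f :: "'b \<Rightarrow> 'b \<Rightarrow> 'a :: idom"
  assumes "\<And>x y. x \<in> set us \<Longrightarrow> y \<in> set vs \<Longrightarrow> f x y = 0"
  shows "det (enum_mat f (us @ vs)) = det (enum_mat f us) * det (enum_mat f vs)"
proof -
  let ?m = "length us" and ?n = "length vs"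
  let ?C = "mat ?n ?m (\<lambda>(i, j). f (vs ! i) (us ! j))"
  have "enum_mat f (us @ vs) =
      four_block_mat (enum_mat f us) (0\<^sub>m ?m ?n) ?C (enum_mat f vs)"
    by (rule eq_matI) (auto simp: nth_append assms)
  then show ?thesis
    using det_four_block_mat_upper_right_zero[of "enum_mat f us" ?m "0\<^sub>m ?m ?n" ?n ?C "enum_mat f vs"]
    by simp
qed

lemma det_enum_mat_diag:
  fixes d :: "'a :: comm_ring_1"
  assumes "distinct vs"
  shows "det (enum_mat (\<lambda>x y. if x = y then d else 0) vs) = d ^ length vs"
proof -
  have "enum_mat (\<lambda>x y. if x = y then d else 0) vs = d \<cdot>\<^sub>m 1\<^sub>m (length vs)"
    using assms by (intro eq_matI) (auto simp: nth_eq_iff_index_eq)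
  then show ?thesis by simp
qed

text \<open>Replacing the first basis vector by the all-ones vector makes the matrix triangular.\<close>

lemma det_scalar_plus_const:
  fixes s c :: "'a :: idom"
  assumes "n > 0"
  shows "det (mat n n (\<lambda>(i, j). (if i = j then s else 0) + c)) = s ^ (n - 1) * (s + of_nat n * c)"
proof -
  define M where "M = mat n n (\<lambda>(i, j). (if i = j then s else 0) + c)"
  define P :: "'a mat" where "P = mat n n (\<lambda>(i, j). if j = 0 \<or> i = j then 1 else 0)"
  \<comment> \<open>\<open>T\<close> expresses \<open>M\<close> in the basis formed by the columns
    of \<open>P\<close>: the all-ones vector is scaled by \<open>s + n c\<close>, and the unit
    vector at \<open>j > 0\<close> goes to \<open>s\<close> times itself plus \<open>c\<close> times
    the all-ones vector.\<close>
  define T where "T = mat n n (\<lambda>(i, j). if i = 0 then (if j = 0 then s + of_nat n * c else c)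
                                        else if i = j then s else 0)"
  have car: "M \<in> carrier_mat n n" "P \<in> carrier_mat n n" "T \<in> carrier_mat n n"
    by (simp_all add: M_def P_def T_def)
  obtain m where n: "n = Suc m" using assms by (cases n) auto
  have "M * P = P * T"
  proof (rule eq_matI)
    fix i j assume "i < dim_row (P * T)" "j < dim_col (P * T)"
    then have ij: "i < n" "j < n" using car by auto
    have "(M * P) $$ (i, j) =
        (\<Sum>k<n. ((if i = k then s else 0) + c) * (if j = 0 \<or> k = j then 1 else 0))"
      using ij car by (simp add: scalar_prod_def M_def P_def lessThan_atLeast0)
    also have "\<dots> = (if j = 0 then s + of_nat n * c else (if i = j then s else 0) + c)"
      using ij by (auto simp: if_distrib [of "\<lambda>x. _ * x"] sum.distrib sum.delta cong: if_cong)
    also have "\<dots> = (\<Sum>k<n. (if k = 0 \<or> i = k then 1 else 0) *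
        (if k = 0 then (if j = 0 then s + of_nat n * c else c) else if k = j then s else 0))"
    proof -
      \<comment> \<open>Once the term \<open>k = 0\<close> is split off, only
        \<open>Suc k = j\<close> can contribute. For \<open>j = 0\<close> the index
        \<open>j - 1\<close> is 0, and the inner condition makes its summand zero.\<close>
      have "(\<Sum>k<m. (if i = Suc k then 1 else 0) * (if Suc k = j then s else 0)) =
          (\<Sum>k<m. if k = j - 1 then (if i = j \<and> j \<noteq> 0 then s else 0) else 0)"
        by (rule sum.cong) auto
      also have "\<dots> = (if i = j \<and> j \<noteq> 0 then s else 0)"
        using ij n by auto
      finally show ?thesis
        by (simp only: n sum.lessThan_Suc_shift) (auto simp: algebra_simps)
    qed
    also have "\<dots> = (P * T) $$ (i, j)"
      using ij car by (simp add: scalar_prod_def T_def P_def lessThan_atLeast0)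
    finally show "(M * P) $$ (i, j) = (P * T) $$ (i, j)" .
  qed (use car in auto)
  then have "det M * det P = det P * det T"
    using det_mult car by metis
  moreover have "det P = 1"
    using det_lower_triangular[of n P] car by (simp add: P_def prod_list_diag_prod)
  moreover have "det T = s ^ (n - 1) * (s + of_nat n * c)"
  proof -
    have "upper_triangular T" by (auto simp: T_def upper_triangular_def)
    then have "det T = (\<Prod>i<n. if i = 0 then s + of_nat n * c else s)"
      using det_upper_triangular[OF _ car(3)]
      by (auto simp: T_def prod_list_diag_prod lessThan_atLeast0 intro!: prod.cong)
    then show ?thesis by (simp add: n prod.lessThan_Suc_shift mult.commute del: prod.lessThan_Suc)
  qed
  ultimately show ?thesis by (simp add: M_def)
qed

text \<open>
  If all rows of \<open>M\<close> sum to \<open>s\<close>, then \<open>M (s I + c J) = s (M + c J)\<close> for the all-ones matrix \<open>J\<close>.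
\<close>

lemma det_enum_mat_add_const:
  fixes f :: "'b \<Rightarrow> 'b \<Rightarrow> 'a :: idom"
  assumes row: "\<And>x. x \<in> set vs \<Longrightarrow> (\<Sum>y\<leftarrow>vs. f x y) = s" and "s \<noteq> 0"
  shows "s * det (enum_mat (\<lambda>x y. f x y + c) vs) =
         (s + of_nat (length vs) * c) * det (enum_mat f vs)"
proof (cases "vs = []")
  case True
  then show ?thesis by (simp add: enum_mat_def)
next
  case False
  define n where "n = length vs"
  have n: "n > 0" using False by (simp add: n_def)
  define N where "N = mat n n (\<lambda>(i, j). (if i = j then s else 0) + c)"
  have N: "N \<in> carrier_mat n n" by (simp add: N_def)
  have M: "enum_mat g vs \<in> carrier_mat n n" for g :: "'b \<Rightarrow> 'b \<Rightarrow> 'a" by (simp add: n_def)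
  have "enum_mat f vs * N = s \<cdot>\<^sub>m enum_mat (\<lambda>x y. f x y + c) vs"
  proof (rule eq_matI)
    fix i j assume "i < dim_row (s \<cdot>\<^sub>m enum_mat (\<lambda>x y. f x y + c) vs)"
      "j < dim_col (s \<cdot>\<^sub>m enum_mat (\<lambda>x y. f x y + c) vs)"
    then have ij: "i < n" "j < n" by (simp_all add: n_def)
    have "(enum_mat f vs * N) $$ (i, j) =
        (\<Sum>k<n. f (vs ! i) (vs ! k) * ((if k = j then s else 0) + c))"
      using ij N by (simp add: scalar_prod_def N_def lessThan_atLeast0 n_def)
    also have "\<dots> = (\<Sum>k<n. (if k = j then f (vs ! i) (vs ! k) * s else 0)) +
        (\<Sum>k<n. f (vs ! i) (vs ! k)) * c"
      by (subst sum_distrib_right, subst sum.distrib[symmetric], rule sum.cong)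
         (auto simp: algebra_simps)
    also have "\<dots> = f (vs ! i) (vs ! j) * s + (\<Sum>k<n. f (vs ! i) (vs ! k)) * c"
      using ij by simp
    also have "(\<Sum>k<n. f (vs ! i) (vs ! k)) = s"
      using row[of "vs ! i"] ij by (simp add: sum_list_sum_nth n_def lessThan_atLeast0)
    finally show "(enum_mat f vs * N) $$ (i, j) =
        (s \<cdot>\<^sub>m enum_mat (\<lambda>x y. f x y + c) vs) $$ (i, j)"
      using ij by (simp add: n_def algebra_simps)
  qed (use N in \<open>auto simp: n_def\<close>)
  then have "det (enum_mat f vs) * det N = s ^ n * det (enum_mat (\<lambda>x y. f x y + c) vs)"
    using det_mult[OF M N, of f] by (simp add: n_def)
  also have "det N = s ^ (n - 1) * (s + of_nat n * c)"
    unfolding N_def by (rule det_scalar_plus_const[OF n])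
  \<comment> \<open>Keeping one factor \<open>s\<close> apart leaves \<open>s ^ (n - 1)\<close> on
    both sides, which cancels in an integral domain.\<close>
  also have "s ^ n = s ^ (n - 1) * s"
    using power_minus_mult[OF n, of s] by simp
  finally have "s ^ (n - 1) * (s * det (enum_mat (\<lambda>x y. f x y + c) vs)) =
      s ^ (n - 1) * ((s + of_nat n * c) * det (enum_mat f vs))"
    by (simp only: mult_ac)
  then show ?thesis using \<open>s \<noteq> 0\<close> unfolding n_def by (subst (asm) mult_cancel_left) auto
qed

text \<open>This is the shape of \<open>x I - L\<close> on a clique of vertices of equal degree: the
  off-diagonal entries are 1, and \<open>d\<close> is \<open>x\<close> minus the degree minus
  1.\<close>

lemma det_enum_mat_diag_add_one:
  fixes d :: "'a :: idom"
  assumes "distinct vs" "vs \<noteq> []"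
  shows "det (enum_mat (\<lambda>x y. (if x = y then d else 0) + 1) vs) =
         d ^ (length vs - 1) * (d + of_nat (length vs))"
proof -
  have "enum_mat (\<lambda>x y. (if x = y then d else 0) + 1) vs =
      mat (length vs) (length vs) (\<lambda>(i, j). (if i = j then d else 0) + 1)"
    using assms by (intro eq_matI) (auto simp: nth_eq_iff_index_eq)
  then show ?thesis
    using assms det_scalar_plus_const[of "length vs" d 1] by simp
qed

section \<open>The Laplacian characteristic polynomial of a clique joined to two disjoint
  cliques\<close>

text \<open>Supplies the constant row sums that \<open>det_enum_mat_add_const\<close> asks
  for.\<close>

lemma sum_list_delta_plus_indicator:
  fixes d :: "'a :: comm_ring_1"
  assumes "distinct ys"
  shows "(\<Sum>y\<leftarrow>ys. (if x = y then d else 0) + (if P y then 0 else 1)) =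
         (if x \<in> set ys then d else 0) + of_nat (card {y \<in> set ys. \<not> P y})"
proof -
  have "(\<Sum>y\<in>set ys. if P y then 0 else 1 :: 'a) = (\<Sum>y | y \<in> set ys \<and> \<not> P y. 1)"
    by (intro sum.mono_neutral_cong_right) auto
  then show ?thesis
    using assms by (simp add: sum_list_distinct_conv_sum_set sum.distrib)
qed

text \<open>
  \<open>\<Gamma>\<close> is the join of a clique on \<open>C\<close> with the disjoint union of cliques on \<open>A\<close> and \<open>B\<close>.
  Subtracting the all-ones matrix from \<open>x I - L\<close> splits off \<open>C\<close>; adding it back on \<open>A \<union> B\<close>
  splits \<open>A\<close> from \<open>B\<close>.
\<close>

lemma char_poly_laplacian_clique_join:
  assumes vs: "distinct vs" "set vs = pverts \<Gamma>"
    and V: "pverts \<Gamma> = C \<union> A \<union> B" "A \<inter> B = {}" "C \<inter> (A \<union> B) = {}"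
    and ne: "A \<noteq> {}" "B \<noteq> {}"
    and arcs: "parcs \<Gamma> = {(x, y). x \<in> pverts \<Gamma> \<and> y \<in> pverts \<Gamma> \<and> x \<noteq> y \<and>
                            \<not> (x \<in> A \<and> y \<in> B) \<and> \<not> (x \<in> B \<and> y \<in> A)}"
  defines "a \<equiv> real (card A)" and "b \<equiv> real (card B)" and "c \<equiv> real (card C)"
  shows "char_poly (laplacian_matrix \<Gamma> vs) =
         [:0, 1:] * [:- (c + a + b), 1:] ^ card C * [:- c, 1:] *
         [:- (c + a), 1:] ^ (card A - 1) * [:- (c + b), 1:] ^ (card B - 1)"
proof -
  \<comment> \<open>On the vertex set, \<open>sep\<close> is non-adjacency of distinct vertices,
    \<open>k x\<close> is the degree of \<open>x\<close> plus one, and \<open>f\<close> gives the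
    entries of \<open>x I - L\<close>; the extra one in \<open>k\<close> makes up for the 1 that
    \<open>f\<close> adds on the diagonal.\<close>
  define sep where "sep x y \<longleftrightarrow> x \<in> A \<and> y \<in> B \<or> x \<in> B \<and> y \<in> A" for x y
  define k where "k x = (if x \<in> C then c + a + b else if x \<in> A then c + a else c + b)" for x
  define f where "f x y = (if x = y then [:- k x, 1:] else 0) + (if sep x y then 0 else 1 :: real poly)"
    for x y
  have "finite (C \<union> A \<union> B)"
    using vs(2) V(1) by (metis List.finite_set)
  then have fin: "finite A" "finite B" "finite C" by auto
  obtain as bs cs where lists: "set as = A" "distinct as" "set bs = B" "distinct bs"
      "set cs = C" "distinct cs"
    using fin finite_distinct_list by metis
  have len: "length as = card A" "length bs = card B" "length cs = card C"
    using lists distinct_card by fastforce+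
  have card_V: "card (C \<union> A \<union> B) = card C + card A + card B"
    using V fin by (simp add: card_Un_disjoint Un_assoc)
  have dist: "distinct (as @ bs)" "distinct (cs @ as @ bs)"
    using lists V by auto
  have "mset vs = mset (cs @ as @ bs)"
    using vs dist(2) lists V by (subst set_eq_iff_mset_eq_distinct[symmetric]) auto
  then have reorder: "det (enum_mat f vs) = det (enum_mat f (cs @ as @ bs))"
    by (rule det_enum_mat_mset_eq)

  \<comment> \<open>The set counted is the closed neighbourhood of \<open>x\<close>; its size gives
    both the degrees and the row sums of \<open>f\<close>.\<close>
  have nbrs: "card {y \<in> C \<union> A \<union> B. \<not> sep x y} =
      (if x \<in> C then card C + card A + card B else if x \<in> A then card C + card A else card C + card B)"
    if "x \<in> C \<union> A \<union> B" for x
  proof -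
    have "{y \<in> C \<union> A \<union> B. \<not> sep x y} =
        (if x \<in> C then C \<union> A \<union> B else if x \<in> A then C \<union> A else C \<union> B)"
      using that V by (auto simp: sep_def)
    moreover have "card (C \<union> A) = card C + card A" "card (C \<union> B) = card C + card B"
      using V(3) fin by (intro card_Un_disjoint; blast)+
    ultimately show ?thesis using card_V by auto
  qed

  have deg: "real (out_degree (with_proj \<Gamma>) x) + 1 = k x" if x: "x \<in> C \<union> A \<union> B" for x
  proof -
    have "out_arcs (with_proj \<Gamma>) x = Pair x ` ({y \<in> C \<union> A \<union> B. \<not> sep x y} - {x})"
      using x unfolding V(1) arcs by (auto simp: out_arcs_def sep_def arcs V(1))
    then have "out_degree (with_proj \<Gamma>) x = card ({y \<in> C \<union> A \<union> B. \<not> sep x y} - {x})"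
      by (simp add: out_degree_def card_image inj_on_def)
    moreover have "x \<in> {y \<in> C \<union> A \<union> B. \<not> sep x y}"
      using x V(2) by (auto simp: sep_def)
    moreover have "finite {y \<in> C \<union> A \<union> B. \<not> sep x y}"
      using fin by simp
    ultimately have "out_degree (with_proj \<Gamma>) x + 1 = card {y \<in> C \<union> A \<union> B. \<not> sep x y}"
      using card_Suc_Diff1 by fastforce
    then have "real (out_degree (with_proj \<Gamma>) x) + 1 = real (card {y \<in> C \<union> A \<union> B. \<not> sep x y})"
      by linarith
    then show ?thesis
      using nbrs[OF x] by (simp add: k_def a_def b_def c_def)
  qed

  have "char_poly_matrix (laplacian_matrix \<Gamma> vs) = enum_mat f vs"
  proof (rule eq_matI)
    fix i j assume "i < dim_row (enum_mat f vs)" "j < dim_col (enum_mat f vs)"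
    then have ij: "i < length vs" "j < length vs" by simp_all
    then have mem: "vs ! i \<in> C \<union> A \<union> B" "vs ! j \<in> C \<union> A \<union> B"
      using vs V(1) nth_mem by metis+
    have "k (vs ! i) - 1 = real (out_degree (with_proj \<Gamma>) (vs ! i))"
      using deg[OF mem(1)] by simp
    moreover have "\<not> sep x x" for x
      using V(2) by (auto simp: sep_def)
    moreover have "(vs ! i, vs ! j) \<in> parcs \<Gamma> \<longleftrightarrow> i \<noteq> j \<and> \<not> sep (vs ! i) (vs ! j)"
      using mem ij vs(1) by (auto simp: arcs V(1) sep_def nth_eq_iff_index_eq)
    ultimately show "char_poly_matrix (laplacian_matrix \<Gamma> vs) $$ (i, j) = enum_mat f vs $$ (i, j)"
      using ij vs(1)
      by (auto simp: char_poly_matrix_def laplacian_matrix_def degree_matrix_def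
          adjacency_matrix_def f_def nth_eq_iff_index_eq one_pCons)
  qed (auto simp: char_poly_matrix_def laplacian_matrix_def degree_matrix_def adjacency_matrix_def)
  then have char: "char_poly (laplacian_matrix \<Gamma> vs) = det (enum_mat f (cs @ as @ bs))"
    by (simp add: char_poly_def reorder)

  have block: "det (enum_mat f us) = [:- r, 1:] ^ (length us - 1) * ([:- r, 1:] + of_nat (length us))"
    if "distinct us" "us \<noteq> []" "\<And>x. x \<in> set us \<Longrightarrow> k x = r" "\<And>x y. x \<in> set us \<Longrightarrow> y \<in> set us \<Longrightarrow> \<not> sep x y"
    for us r
  proof -
    have "enum_mat f us = enum_mat (\<lambda>x y. (if x = y then [:- r, 1:] else 0) + 1) us"
      using that by (intro enum_mat_cong) (auto simp: f_def)
    then show ?thesis using det_enum_mat_diag_add_one[OF that(1,2), of "[:- r, 1:]"] by simp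
  qed
  \<comment> \<open>\<open>f\<close> vanishes between \<open>A\<close> and \<open>B\<close>. Each of
    the two blocks contributes one factor \<open>x - c\<close>, since
    \<open>x - (c + a) + a = x - (c + b) + b\<close>.\<close>
  have "det (enum_mat f (as @ bs)) = det (enum_mat f as) * det (enum_mat f bs)"
    using lists V by (intro det_enum_mat_append) (auto simp: f_def sep_def)
  moreover have "det (enum_mat f as) = [:- (c + a), 1:] ^ (card A - 1) * [:- c, 1:]"
  proof -
    have "det (enum_mat f as) = [:- (c + a), 1:] ^ (length as - 1) * ([:- (c + a), 1:] + of_nat (length as))"
      using lists V ne by (intro block) (auto simp: k_def sep_def)
    then show ?thesis by (simp add: len of_nat_poly a_def)
  qed
  moreover have "det (enum_mat f bs) = [:- (c + b), 1:] ^ (card B - 1) * [:- c, 1:]"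
  proof -
    have "det (enum_mat f bs) = [:- (c + b), 1:] ^ (length bs - 1) * ([:- (c + b), 1:] + of_nat (length bs))"
      using lists V ne by (intro block) (auto simp: k_def sep_def)
    then show ?thesis by (simp add: len of_nat_poly b_def)
  qed
  ultimately have det_AB: "det (enum_mat f (as @ bs)) =
      [:- c, 1:] ^ 2 * [:- (c + a), 1:] ^ (card A - 1) * [:- (c + b), 1:] ^ (card B - 1)"
    by (simp only: power2_eq_square mult_ac)

  \<comment> \<open>On \<open>A\<close> and \<open>B\<close> together every row of \<open>f\<close>
    sums to \<open>x - c\<close>, so subtracting the all-ones matrix trades one factor
    \<open>x - c\<close> for \<open>x - (c + a + b)\<close>.\<close>
  define g where "g x y = f x y + - 1" for x y
  have "[:- c, 1:] * det (enum_mat g (as @ bs)) =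
      ([:- c, 1:] + of_nat (length (as @ bs)) * - 1) * det (enum_mat f (as @ bs))"
    unfolding g_def
  proof (rule det_enum_mat_add_const)
    fix x assume x: "x \<in> set (as @ bs)"
    have "{y \<in> set (as @ bs). \<not> sep x y} = (if x \<in> A then A else B)"
      using x V lists by (auto simp: sep_def)
    then have "(\<Sum>y\<leftarrow>as @ bs. f x y) = [:- k x, 1:] + of_nat (if x \<in> A then card A else card B)"
      using x unfolding f_def by (subst sum_list_delta_plus_indicator[OF dist(1)]) auto
    then show "(\<Sum>y\<leftarrow>as @ bs. f x y) = [:- c, 1:]"
      using x V lists by (auto simp: k_def of_nat_poly a_def b_def)
  qed simp
  also have "[:- c, 1:] + of_nat (length (as @ bs)) * - 1 = [:- (c + a + b), 1:]"
    by (simp add: of_nat_poly a_def b_def len)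
  finally have "[:- c, 1:] * det (enum_mat g (as @ bs)) = [:- c, 1:] *
      ([:- (c + a + b), 1:] * [:- c, 1:] * [:- (c + a), 1:] ^ (card A - 1) * [:- (c + b), 1:] ^ (card B - 1))"
    unfolding det_AB power2_eq_square by (simp only: mult_ac)
  then have det_AB': "det (enum_mat g (as @ bs)) =
      [:- (c + a + b), 1:] * [:- c, 1:] * [:- (c + a), 1:] ^ (card A - 1) * [:- (c + b), 1:] ^ (card B - 1)"
    by (subst (asm) mult_cancel_left) simp

  \<comment> \<open>Vertices of \<open>C\<close> are adjacent to all others, so in their rows
    \<open>g\<close> is zero off the diagonal.\<close>
  have "enum_mat g cs = enum_mat (\<lambda>x y. if x = y then [:- (c + a + b), 1:] else 0) cs"
    using lists V by (intro enum_mat_cong) (auto simp: g_def f_def k_def sep_def)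
  then have "det (enum_mat g cs) = [:- (c + a + b), 1:] ^ card C"
    by (simp only: det_enum_mat_diag[OF lists(6)] len)
  moreover have "det (enum_mat g (cs @ as @ bs)) = det (enum_mat g cs) * det (enum_mat g (as @ bs))"
    using lists V by (intro det_enum_mat_append) (auto simp: g_def f_def sep_def)
  \<comment> \<open>Rows of a Laplacian sum to zero, so those of \<open>x I - L\<close> sum to
    \<open>x\<close>. Here the all-ones matrix is subtracted on the whole vertex set.\<close>
  moreover have "[:0, 1:] * det (enum_mat g (cs @ as @ bs)) =
      ([:0, 1:] + of_nat (length (cs @ as @ bs)) * - 1) * det (enum_mat f (cs @ as @ bs))"
    unfolding g_def
  proof (rule det_enum_mat_add_const)
    fix x assume "x \<in> set (cs @ as @ bs)"
    then have x: "x \<in> C \<union> A \<union> B" using lists by auto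
    have "set (cs @ as @ bs) = C \<union> A \<union> B" using lists by auto
    then have "(\<Sum>y\<leftarrow>cs @ as @ bs. f x y) = [:- k x, 1:] + of_nat (card {y \<in> C \<union> A \<union> B. \<not> sep x y})"
      using x unfolding f_def by (subst sum_list_delta_plus_indicator[OF dist(2)]) auto
    then show "(\<Sum>y\<leftarrow>cs @ as @ bs. f x y) = [:0, 1:]"
      using x unfolding nbrs[OF x] by (auto simp: k_def of_nat_poly a_def b_def c_def)
  qed simp
  moreover have "[:0, 1:] + of_nat (length (cs @ as @ bs)) * - 1 = [:- (c + a + b), 1:]"
    by (simp add: of_nat_poly a_def b_def c_def len)
  ultimately have "[:- (c + a + b), 1:] * det (enum_mat f (cs @ as @ bs)) = [:- (c + a + b), 1:] *
      ([:0, 1:] * [:- (c + a + b), 1:] ^ card C * [:- c, 1:] *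
       [:- (c + a), 1:] ^ (card A - 1) * [:- (c + b), 1:] ^ (card B - 1))"
    unfolding det_AB' by (simp only: mult_ac)
  then show ?thesis
    unfolding char by (subst (asm) mult_cancel_left) simp
qed

section \<open>Element orders in direct products and in dihedral groups\<close>

text \<open>Powers are componentwise, so a power of \<open>(x, y)\<close> is trivial exactly when
  its exponent is a common multiple of both orders.\<close>

lemma ord_DirProd:
  assumes G: "group G" and H: "group H" and x: "x \<in> carrier G" and y: "y \<in> carrier H"
  shows "group.ord (G \<times>\<times> H) (x, y) = lcm (group.ord G x) (group.ord H y)"
proof -
  interpret G: group G by (rule G)
  interpret H: group H by (rule H)
  interpret GH: group "G \<times>\<times> H" by (rule DirProd_group[OF G H])
  have pow: "(x, y) [^]\<^bsub>G \<times>\<times> H\<^esub> n = (x [^]\<^bsub>G\<^esub> n, y [^]\<^bsub>H\<^esub> n)" for n :: nat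
    by (induction n) simp_all
  have "(x, y) \<in> carrier (G \<times>\<times> H)" using x y by simp
  then show ?thesis
    by (subst GH.ord_unique) (simp_all add: pow x y G.pow_eq_id H.pow_eq_id)
qed

text \<open>The rotations are the powers of \<open>a\<close>; by counting, the coset of \<open>b\<close> is all the rest.\<close>

lemma dihedral_group_ord_cases:
  assumes D: "dihedral_group p D" and p: "Factorial_Ring.prime p" "odd p"
  obtains R S where "carrier D = insert \<one>\<^bsub>D\<^esub> (R \<union> S)" "\<one>\<^bsub>D\<^esub> \<notin> R" "\<one>\<^bsub>D\<^esub> \<notin> S" "R \<inter> S = {}"
    "card R = p - 1" "card S = p"
    "\<And>x. x \<in> R \<Longrightarrow> group.ord D x = p" "\<And>x. x \<in> S \<Longrightarrow> group.ord D x = 2"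
proof -
  interpret group D using D by (simp add: dihedral_group_def)
  obtain a b where ab: "a \<in> carrier D" "b \<in> carrier D" and ord: "ord a = p" "ord b = 2"
    and ba: "b \<otimes>\<^bsub>D\<^esub> a = inv\<^bsub>D\<^esub> a \<otimes>\<^bsub>D\<^esub> b" and card_D: "card (carrier D) = 2 * p"
    using D unfolding dihedral_group_def by metis
  have p0: "p > 0" using p prime_gt_0_nat by blast
  have fin: "finite (carrier D)" using card_D p0 card.infinite by fastforce
  define H where "H = generate D {a}"
  have sub: "subgroup H D" unfolding H_def using ab by (intro generate_is_subgroup) simp
  have H_car: "H \<subseteq> carrier D" using sub subgroup.subset by blast
  have H_memD: "h \<in> carrier D" if "h \<in> H" for h using H_car that by blast
  have card_H: "card H = p" unfolding H_def using generate_pow_card[OF ab(1)] ord by simp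
  have finH: "finite H" using H_car fin finite_subset by blast
  have H_pow: "H = {a [^]\<^bsub>D\<^esub> k | k. k \<in> (UNIV :: nat set)}"
    unfolding H_def using generate_pow_on_finite_carrier[OF fin ab(1)] by simp
  \<comment> \<open>A power of \<open>a\<close> has trivial \<open>p\<close>-th power, so its order
    divides the prime \<open>p\<close>.\<close>
  have ord_H: "ord x = p" if x: "x \<in> H - {\<one>\<^bsub>D\<^esub>}" for x
  proof -
    have xc: "x \<in> carrier D" using x H_car by blast
    obtain k :: nat where "x = a [^]\<^bsub>D\<^esub> k" using x H_pow by auto
    then have "x [^]\<^bsub>D\<^esub> p = \<one>\<^bsub>D\<^esub>"
      using ab ord by (metis mult.commute nat_pow_one nat_pow_pow pow_ord_eq_1)
    then have "ord x dvd p" using pow_eq_id[OF xc] by simp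
    then show ?thesis using p(1) ord_eq_1[OF xc] x prime_nat_iff by auto
  qed
  \<comment> \<open>Members of \<open>H\<close> have order 1 or the odd prime \<open>p\<close>,
    whereas \<open>b\<close> has order 2.\<close>
  have b_notin: "b \<notin> H"
    using ord_H[of b] ord p by force
  define S where "S = (\<lambda>h. h \<otimes>\<^bsub>D\<^esub> b) ` H"
  have S_car: "S \<subseteq> carrier D" using H_car ab by (auto simp: S_def)
  have card_S: "card S = p"
    unfolding S_def using card_H ab by (subst card_image) (auto simp: inj_on_def H_memD)
  have disj: "H \<inter> S = {}"
  proof -
    have False if "h \<in> H" "h \<otimes>\<^bsub>D\<^esub> b \<in> H" for h
    proof -
      have "inv\<^bsub>D\<^esub> h \<otimes>\<^bsub>D\<^esub> (h \<otimes>\<^bsub>D\<^esub> b) \<in> H"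
        using that sub by (simp add: subgroup.m_closed subgroup.m_inv_closed)
      then show False using b_notin ab that by (simp add: m_assoc[symmetric] H_memD)
    qed
    then show ?thesis by (auto simp: S_def)
  qed
  have "card (H \<union> S) = 2 * p"
    using card_H card_S disj finH by (subst card_Un_disjoint) (auto simp: S_def)
  then have car: "carrier D = H \<union> S"
    using card_subset_eq[OF fin, of "H \<union> S"] H_car S_car card_D by simp
  \<comment> \<open>Moving \<open>b\<close> past a rotation inverts it; hence the square of
    \<open>a^k b\<close> collapses to \<open>b b\<close>, which is trivial.\<close>
  have b_pow: "b \<otimes>\<^bsub>D\<^esub> a [^]\<^bsub>D\<^esub> k = inv\<^bsub>D\<^esub> (a [^]\<^bsub>D\<^esub> k) \<otimes>\<^bsub>D\<^esub> b" for k :: nat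
  proof (induction k)
    case 0
    then show ?case using ab by simp
  next
    case (Suc k)
    have "b \<otimes>\<^bsub>D\<^esub> a [^]\<^bsub>D\<^esub> Suc k = inv\<^bsub>D\<^esub> (a [^]\<^bsub>D\<^esub> k) \<otimes>\<^bsub>D\<^esub> (b \<otimes>\<^bsub>D\<^esub> a)"
      using ab Suc by (simp add: m_assoc[symmetric])
    also have "\<dots> = inv\<^bsub>D\<^esub> (a \<otimes>\<^bsub>D\<^esub> a [^]\<^bsub>D\<^esub> k) \<otimes>\<^bsub>D\<^esub> b"
      using ab by (simp add: ba m_assoc inv_mult_group)
    finally show ?case using ab by (simp add: pow_mult_distrib nat_pow_comm nat_pow_Suc2[symmetric] del: nat_pow_Suc)
  qed
  have ord_S: "ord x = 2" if x: "x \<in> S" for x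
  proof -
    have xc: "x \<in> carrier D" using x S_car by blast
    obtain k :: nat where k: "x = a [^]\<^bsub>D\<^esub> k \<otimes>\<^bsub>D\<^esub> b" using x H_pow by (auto simp: S_def)
    have "b \<otimes>\<^bsub>D\<^esub> b = \<one>\<^bsub>D\<^esub>"
      using pow_ord_eq_1[OF ab(2)] ord ab by (simp add: numeral_2_eq_2)
    then have "x \<otimes>\<^bsub>D\<^esub> x = \<one>\<^bsub>D\<^esub>"
    proof -
      have "x \<otimes>\<^bsub>D\<^esub> x = a [^]\<^bsub>D\<^esub> k \<otimes>\<^bsub>D\<^esub> (b \<otimes>\<^bsub>D\<^esub> a [^]\<^bsub>D\<^esub> k) \<otimes>\<^bsub>D\<^esub> b"
        using ab by (simp add: k m_assoc)
      also have "\<dots> = b \<otimes>\<^bsub>D\<^esub> b"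
        using ab by (simp add: b_pow m_assoc[symmetric])
      finally show ?thesis using \<open>b \<otimes>\<^bsub>D\<^esub> b = \<one>\<^bsub>D\<^esub>\<close> by simp
    qed
    then have "x [^]\<^bsub>D\<^esub> (2::nat) = \<one>\<^bsub>D\<^esub>" using xc by (simp add: numeral_2_eq_2)
    then have "ord x dvd 2" using pow_eq_id[OF xc] by simp
    moreover have "ord x \<noteq> 1"
      using ord_eq_1[OF xc] x disj sub subgroup.one_closed by fastforce
    ultimately show ?thesis
      using two_is_prime_nat prime_nat_iff by blast
  qed
  have one: "\<one>\<^bsub>D\<^esub> \<in> H" using sub by (simp add: subgroup.one_closed)
  show thesis
  proof (rule that[of "H - {\<one>\<^bsub>D\<^esub>}" S])
    show "carrier D = insert \<one>\<^bsub>D\<^esub> (H - {\<one>\<^bsub>D\<^esub>} \<union> S)" using car one by auto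
    show "card (H - {\<one>\<^bsub>D\<^esub>}) = p - 1" using card_H one finH by simp
  qed (use one disj ord_H ord_S card_S in auto)
qed

section \<open>The spectrum for the direct square of the dihedral group\<close>

lemma laplacian_matrix_carrier: "laplacian_matrix \<Gamma> vs \<in> carrier_mat (length vs) (length vs)"
  unfolding laplacian_matrix_def adjacency_matrix_def by (intro minus_carrier_mat mat_carrier)

lemma order_linear_power:
  fixes r s :: "'a :: idom"
  shows "Polynomial.order r ([:- s, 1:] ^ m) = (if r = s then m else 0)"
  by (auto simp: order_power_n_n intro!: order_0I)

theorem corollary3p2:
  fixes p :: nat and D :: "'a monoid" and vs :: "('a \<times> 'a) list"
  assumes "Factorial_Ring.prime p" and "odd p"
    and "dihedral_group p D"
    and "distinct vs" and "set vs = pverts (superpower_graph (D \<times>\<times> D))"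
  defines "L \<equiv> laplacian_matrix (superpower_graph (D \<times>\<times> D)) vs"
  shows "spectrum L =
           {3 * real p ^ 2 - 2 * real p, 4 * real p ^ 2, 3 * real p ^ 2 + 1,
            2 * real p ^ 2 - 2 * real p + 1, 0}
       \<and> eigenvalue_multiplicity L (3 * real p ^ 2 - 2 * real p) = p ^ 2 - 2
       \<and> eigenvalue_multiplicity L (4 * real p ^ 2) = 2 * p ^ 2 - 2 * p + 1
       \<and> eigenvalue_multiplicity L (3 * real p ^ 2 + 1) = p ^ 2 + 2 * p - 1
       \<and> eigenvalue_multiplicity L (2 * real p ^ 2 - 2 * real p + 1) = 1
       \<and> eigenvalue_multiplicity L 0 = 1"
proof -
  obtain R S where car: "carrier D = insert \<one>\<^bsub>D\<^esub> (R \<union> S)"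
    and disj: "\<one>\<^bsub>D\<^esub> \<notin> R" "\<one>\<^bsub>D\<^esub> \<notin> S" "R \<inter> S = {}"
    and card_RS: "card R = p - 1" "card S = p"
    and ord_RS: "\<And>x. x \<in> R \<Longrightarrow> group.ord D x = p" "\<And>x. x \<in> S \<Longrightarrow> group.ord D x = 2"
    using dihedral_group_ord_cases[OF assms(3,1,2)] by metis
  have D: "group D" using assms(3) by (simp add: dihedral_group_def)
  have p3: "p \<ge> 3"
    using assms(1,2) prime_ge_2_nat[of p] by (cases "p = 2") auto
  have fin: "finite R" "finite S"
    using card_RS p3 card.infinite by fastforce+

  define e where "e = (\<one>\<^bsub>D\<^esub>, \<one>\<^bsub>D\<^esub>)"
  \<comment> \<open>\<open>A\<close> collects the pairs of order \<open>p\<close>, \<open>B\<close>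
    those of order 2, and \<open>C\<close> the identity together with the mixed pairs of order
    \<open>2 * p\<close>.\<close>
  define A where "A = insert \<one>\<^bsub>D\<^esub> R \<times> insert \<one>\<^bsub>D\<^esub> R - {e}"
  define B where "B = insert \<one>\<^bsub>D\<^esub> S \<times> insert \<one>\<^bsub>D\<^esub> S - {e}"
  define C where "C = insert e (R \<times> S \<union> S \<times> R)"
  have V: "carrier (D \<times>\<times> D) = C \<union> A \<union> B"
    by (auto simp: car A_def B_def C_def e_def)
  have dis: "A \<inter> B = {}" "C \<inter> (A \<union> B) = {}"
    using disj by (auto simp: A_def B_def C_def e_def)

  have p_pos: "p > 0" and p_sq: "p ^ 2 \<ge> 3 * p"
    using p3 by (auto simp: power2_eq_square)
  have card_square: "card (insert \<one>\<^bsub>D\<^esub> X \<times> insert \<one>\<^bsub>D\<^esub> X - {e}) = (card X + 1) ^ 2 - 1"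
    if "finite X" "\<one>\<^bsub>D\<^esub> \<notin> X" for X
  proof -
    have "card (insert \<one>\<^bsub>D\<^esub> X \<times> insert \<one>\<^bsub>D\<^esub> X) = (card X + 1) ^ 2"
      using that unfolding card_cartesian_product by (simp add: power2_eq_square)
    then show ?thesis
      using that by (subst card_Diff_singleton) (auto simp: e_def)
  qed
  have card_A: "card A = p ^ 2 - 1"
    using card_square[of R] fin disj card_RS p_pos by (simp add: A_def)
  have card_B: "card B = p ^ 2 + 2 * p"
    using card_square[of S] fin disj card_RS by (simp add: B_def power2_eq_square)
  have card_C: "card C = 2 * p ^ 2 - 2 * p + 1"
  proof -
    have "card (R \<times> S \<union> S \<times> R) = (p - 1) * p + p * (p - 1)"
      using disj fin card_RS by (subst card_Un_disjoint) (auto simp: card_cartesian_product)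
    moreover have "e \<notin> R \<times> S \<union> S \<times> R" using disj by (auto simp: e_def)
    ultimately have "card C = (p - 1) * p + p * (p - 1) + 1" using fin by (simp add: C_def)
    then show ?thesis by (simp add: power2_eq_square algebra_simps)
  qed
  have ne: "A \<noteq> {}" "B \<noteq> {}"
    using card_A card_B p3 p_sq by auto

  have ord: "group.ord (D \<times>\<times> D) (x, y) = lcm (group.ord D x) (group.ord D y)"
    if "x \<in> carrier D" "y \<in> carrier D" for x y
    using ord_DirProd[OF D D that] .
  have one: "group.ord D \<one>\<^bsub>D\<^esub> = 1" using group.ord_id[OF D] .
  have lcm2p: "lcm p 2 = 2 * p" "lcm 2 p = 2 * p"
    using assms(2) by (simp_all add: lcm_nat_def coprime_imp_gcd_eq_1)
  have ord_A: "group.ord (D \<times>\<times> D) z = p" if "z \<in> A" for z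
    using that by (auto simp: A_def e_def ord car one ord_RS)
  have ord_B: "group.ord (D \<times>\<times> D) z = 2" if "z \<in> B" for z
    using that by (auto simp: B_def e_def ord car one ord_RS)
  have ord_C: "group.ord (D \<times>\<times> D) z \<in> {1, 2 * p}" if "z \<in> C" for z
    using that by (auto simp: C_def e_def ord car one ord_RS lcm2p)
  have ndvd: "\<not> p dvd 2" "\<not> 2 dvd p"
    using assms(2) p3 dvd_imp_le[of p 2] by auto
  \<comment> \<open>Among the orders 1, 2, \<open>p\<close> and \<open>2 * p\<close>, only 2 and
    \<open>p\<close> are incomparable under divisibility.\<close>
  have adj: "group.ord (D \<times>\<times> D) x dvd group.ord (D \<times>\<times> D) y \<or>
        group.ord (D \<times>\<times> D) y dvd group.ord (D \<times>\<times> D) x \<longleftrightarrow>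
      \<not> (x \<in> A \<and> y \<in> B) \<and> \<not> (x \<in> B \<and> y \<in> A)"
    if "x \<in> C \<union> A \<union> B" "y \<in> C \<union> A \<union> B" for x y
    using that dis ord_A[of x] ord_A[of y] ord_B[of x] ord_B[of y] ord_C[of x] ord_C[of y] ndvd
    by auto

  let ?a = "real (card A)" and ?b = "real (card B)" and ?c = "real (card C)"
  have "parcs (superpower_graph (D \<times>\<times> D)) =
      {(x, y). x \<in> C \<union> A \<union> B \<and> y \<in> C \<union> A \<union> B \<and> x \<noteq> y \<and>
        \<not> (x \<in> A \<and> y \<in> B) \<and> \<not> (x \<in> B \<and> y \<in> A)}"
    unfolding superpower_graph_def V using adj by auto
  then have char: "char_poly L =
      [:0, 1:] * [:- (?c + ?a + ?b), 1:] ^ card C * [:- ?c, 1:] *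
      [:- (?c + ?a), 1:] ^ (card A - 1) * [:- (?c + ?b), 1:] ^ (card B - 1)"
    unfolding L_def using assms(4,5) V dis ne
    by (intro char_poly_laplacian_clique_join) (auto simp: superpower_graph_def)
  \<comment> \<open>The bounds on \<open>p\<close> ensure that the natural-number subtractions agree
    with the real ones.\<close>
  have real: "?a = real p ^ 2 - 1" "?b = real p ^ 2 + 2 * real p" "?c = 2 * real p ^ 2 - 2 * real p + 1"
    using p_sq p_pos by (simp_all add: card_A card_B card_C of_nat_diff)
  have ev: "?c + ?a = 3 * real p ^ 2 - 2 * real p" "?c + ?a + ?b = 4 * real p ^ 2"
      "?c + ?b = 3 * real p ^ 2 + 1"
    by (simp_all add: real)
  define l1 l2 l3 l4 where "l1 = 3 * real p ^ 2 - 2 * real p" and "l2 = 4 * real p ^ 2"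
    and "l3 = 3 * real p ^ 2 + 1" and "l4 = 2 * real p ^ 2 - 2 * real p + 1"
  note l_defs = l1_def l2_def l3_def l4_def
  \<comment> \<open>Every factor, including the root 0 and the exponents 1, is put in the form
    \<open>[:- s, 1:] ^ m\<close>, so that its order at any point is known.\<close>
  have char': "char_poly L = [:- 0, 1:] ^ 1 * [:- l2, 1:] ^ (2 * p ^ 2 - 2 * p + 1) *
      [:- l4, 1:] ^ 1 * [:- l1, 1:] ^ (p ^ 2 - 2) * [:- l3, 1:] ^ (p ^ 2 + 2 * p - 1)"
    unfolding char ev(2) unfolding ev(1,3) l_defs unfolding real(3) unfolding card_A card_B card_C
    by (simp only: power_one_right minus_zero diff_diff_left one_add_one)
  have nz: "[:- l, 1:] ^ m \<noteq> 0" for l :: real and m by simp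
  \<comment> \<open>The order is additive over a nonzero product; coinciding roots would simply add
    up, so distinctness enters only afterwards.\<close>
  have mult: "eigenvalue_multiplicity L r =
      (if r = 0 then 1 else 0) + (if r = l2 then 2 * p ^ 2 - 2 * p + 1 else 0) +
      (if r = l4 then 1 else 0) + (if r = l1 then p ^ 2 - 2 else 0) +
      (if r = l3 then p ^ 2 + 2 * p - 1 else 0)" for r
    unfolding eigenvalue_multiplicity_def char'
    by (simp only: order_mult order_linear_power nz mult_eq_0_iff simp_thms)
  have L: "L \<in> carrier_mat (length vs) (length vs)"
    unfolding L_def by (rule laplacian_matrix_carrier)
  have "char_poly L \<noteq> 0"
    unfolding char' by (simp only: nz mult_eq_0_iff simp_thms)
  then have spec: "r \<in> spectrum L \<longleftrightarrow> eigenvalue_multiplicity L r \<noteq> 0" for r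
    unfolding spectrum_def eigenvalue_multiplicity_def
    using eigenvalue_root_char_poly[OF L] by (simp add: order_root)
  \<comment> \<open>With \<open>p ^ 2\<close> treated as a separate unknown, these bounds yield
    \<open>0 < l4 < l1 < l3 < l2\<close> by linear arithmetic.\<close>
  have "real p ^ 2 \<ge> 3 * real p" "real p \<ge> 3"
    using p3 of_nat_mono[OF p_sq, where 'a = real] by simp_all
  then have ne: "l1 \<noteq> l2" "l1 \<noteq> l3" "l1 \<noteq> l4" "l1 \<noteq> 0"
      "l2 \<noteq> l3" "l2 \<noteq> l4" "l2 \<noteq> 0" "l3 \<noteq> l4" "l3 \<noteq> 0" "l4 \<noteq> 0"
    unfolding l_defs by linarith+
  \<comment> \<open>The truncated differences stay positive, so \<open>l1\<close> and
    \<open>l3\<close> really occur as eigenvalues.\<close>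
  have pos: "p ^ 2 - 2 \<noteq> 0" "p ^ 2 + 2 * p - 1 \<noteq> 0"
    using p3 p_sq by linarith+
  have "r \<in> spectrum L \<longleftrightarrow> r \<in> {l1, l2, l3, l4, 0}" for r
    unfolding spec mult using pos by simp
  then have "spectrum L = {l1, l2, l3, l4, 0}" by blast
  then show ?thesis
    unfolding l_defs[symmetric] by (simp add: mult ne ne[symmetric])
qed

end
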